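(* For any integer $n \ge 0$, we have \[\mathrm{pod}_{-4}(5n+2)\equiv \mathrm{pod}_{-4}(5n+4)\equiv 0 \pmod{5}.\]
   Context: For a positive integer $k$, $\mathrm{pod}_{-k}(n)$ denotes the number of partition $k$-tuples of $n$ (that is, $k$-tuples of partitions whose sizes sum to $n$) such that in each of the $k$ partitions the odd parts are distinct. Its generating function is \[\sum_{n\ge 0}\mathrm{pod}_{-k}(n)q^n=\prod_{j\ge 1}\frac{(1+q^{2j-1})^k}{(1-q^{2j})^k}=\frac{1}{\psi(-q)^k},\qquad \psi(q)=\sum_{n=0}^{\infty}q^{n(n+1)/2}.\] *)

theory Defs
  imports "HOL-Library.Multiset" "HOL-Number_Theory.Cong"
begin

text \<open>A partition is the finite multiset of its parts, which are positive; its size is the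
  sum of the parts, \<open>sum_mset p\<close> (not the multiset cardinality \<open>size p\<close>).\<close>

definition is_partition :: "nat multiset \<Rightarrow> bool" where
  "is_partition p \<longleftrightarrow> (\<forall>i \<in># p. i > 0)"

definition odd_parts_distinct :: "nat multiset \<Rightarrow> bool" where
  "odd_parts_distinct p \<longleftrightarrow> (\<forall>i. odd i \<longrightarrow> count p i \<le> 1)"

definition pod_tuples :: "nat \<Rightarrow> nat \<Rightarrow> nat multiset list set" where
  "pod_tuples k n = {ps. length ps = k \<and>
     (\<forall>p \<in> set ps. is_partition p \<and> odd_parts_distinct p) \<and>
     (\<Sum>p\<leftarrow>ps. sum_mset p) = n}"

text \<open>\<open>pod_neg k n\<close> is the number written pod with subscript \<open>-k\<close>, at \<open>n\<close>;
  \<open>finite_pod_tuples\<close> below shows that the cardinality is that of a finite set.\<close>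

definition pod_neg :: "nat \<Rightarrow> nat \<Rightarrow> nat" where
  "pod_neg k n = card (pod_tuples k n)"

lemma size_le_sum_mset:
  fixes p :: "nat multiset"
  assumes "0 \<notin># p"
  shows "size p \<le> sum_mset p"
  using assms by (induction p) auto

lemma finite_pod_tuples: "finite (pod_tuples k n)"
proof -
  have "finite (\<Union>m\<le>n. {p :: nat multiset. set_mset p \<subseteq> {..n} \<and> size p = m})"
    using finite_multisets_of_size[of "{..n}"] by (auto simp: multisets_of_size_def)
  moreover have "pod_tuples k n \<subseteq>
      {ps. set ps \<subseteq> (\<Union>m\<le>n. {p. set_mset p \<subseteq> {..n} \<and> size p = m}) \<and> length ps = k}"
  proof
    fix ps assume ps: "ps \<in> pod_tuples k n"
    have "set_mset p \<subseteq> {..n} \<and> size p \<le> n" if "p \<in> set ps" for p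
    proof -
      have "sum_mset p \<le> (\<Sum>p\<leftarrow>ps. sum_mset p)"
        using that by (intro member_le_sum_list) auto
      then have le: "sum_mset p \<le> n" using ps by (simp add: pod_tuples_def)
      have "0 \<notin># p" using ps that by (auto simp: pod_tuples_def is_partition_def)
      then have "size p \<le> n" using size_le_sum_mset le by fastforce
      moreover have "x \<le> n" if "x \<in># p" for x
        using that le by (auto dest!: multi_member_split)
      ultimately show ?thesis by auto
    qed
    then show "ps \<in> {ps. set ps \<subseteq> (\<Union>m\<le>n. {p. set_mset p \<subseteq> {..n} \<and> size p = m}) \<and> length ps = k}"
      using ps by (auto simp: pod_tuples_def)
  qed
  ultimately show ?thesis
    by (rule finite_subset[rotated, OF finite_lists_length_eq])
qed

end

theory Submission
  imports Defs "HOL-Computational_Algebra.Formal_Power_Series"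
begin

text \<open>
  Let \<open>F\<close> be the generating function of partitions with distinct odd parts. By Gauss's identity
  \<open>F * \<psi>(-q) = 1\<close>, so \<open>F^4 = F^5 * \<psi>(-q)\<close>. Modulo 5 the series \<open>F^5\<close> is
  supported on multiples of 5, because \<open>(F^5)' = 5 * F^4 * F'\<close>, while triangular numbers
  are never 2 or 4 modulo 5. Gauss's identity follows from a finite version due to Shanks,
  which is proved by telescoping.
\<close>

unbundle fps_syntax

section \<open>Shanks's finite form of Gauss's identity\<close>

lemma prod_greaterThanAtMost_Suc_left:
  fixes f :: "nat \<Rightarrow> 'a::comm_monoid_mult"
  assumes "s < n"
  shows "prod f {s<..n} = f (Suc s) * prod f {Suc s<..n}"
proof -
  have "{s<..n} = insert (Suc s) {Suc s<..n}" using assms by auto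
  then show ?thesis by simp
qed

lemma prod_greaterThanAtMost_Suc_right:
  fixes f :: "nat \<Rightarrow> 'a::comm_monoid_mult"
  assumes "s \<le> n"
  shows "prod f {s<..Suc n} = prod f {s<..n} * f (Suc n)"
proof -
  have "{s<..Suc n} = insert (Suc n) {s<..n}" using assms by auto
  then show ?thesis by (simp add: mult.commute)
qed

text \<open>Clearing denominators lets the identity hold in every commutative ring. Shanks's
  quotients of products of \<open>1 - q ^ (2 * k)\<close> by products of
  \<open>1 - q ^ (2 * k + 1)\<close> have been multiplied by the full odd product. Later
  \<open>q\<close> becomes \<open>- fps_X\<close>, which turns the odd factors into
  \<open>1 + fps_X ^ (2 * k + 1)\<close> and leaves the even ones unchanged.\<close>

theorem shanks_identity:
  fixes q :: "'a::comm_ring_1"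
  shows "(\<Prod>k<n. 1 - q ^ (2 * k + 1)) * (\<Sum>j\<le>2 * n. q ^ (j * (j + 1) div 2)) =
    (\<Sum>s\<le>n. (\<Prod>k\<in>{s<..n}. 1 - q ^ (2 * k)) * (\<Prod>k<s. 1 - q ^ (2 * k + 1)) * q ^ (s * (2 * n + 1)))"
proof (induction n)
  case 0
  show ?case by simp
next
  case (Suc n)
  define A where "A s m = (\<Prod>k\<in>{s<..m}. 1 - q ^ (2 * k))" for s m
  define B where "B s = (\<Prod>k<s. 1 - q ^ (2 * k + 1))" for s
  define T where "T s = A s n * B s * q ^ (s * (2 * n + 1))" for s
  \<comment> \<open>The factor \<open>1 - q ^ (2 * n + 1)\<close> is what the odd product on the
    left gains when \<open>n\<close> increases. So \<open>d s\<close> is the change of the summand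
    \<open>s\<close> that is left to account for.\<close>
  define d where "d s = A s (Suc n) * B s * q ^ (s * (2 * n + 3)) - (1 - q ^ (2 * n + 1)) * T s" for s
  have B_Suc: "B (Suc s) = B s * (1 - q ^ (2 * s + 1))" for s
    by (simp add: B_def)
  have A_self: "A s s = 1" for s by (simp add: A_def)
  have d_eq: "d s = T s * q ^ (2 * n + 1) * (1 - q ^ (2 * s + 1)) - T s * (1 - q ^ (2 * s))"
    if "s \<le> n" for s
  proof -
    have "A s (Suc n) = A s n * (1 - q ^ (2 * n + 2))"
      unfolding A_def using that by (subst prod_greaterThanAtMost_Suc_right) auto
    moreover have "q ^ (s * (2 * n + 3)) = q ^ (s * (2 * n + 1)) * q ^ (2 * s)"
      by (simp add: power_add[symmetric] algebra_simps)
    ultimately have "A s (Suc n) * B s * q ^ (s * (2 * n + 3)) = T s * (q ^ (2 * s) * (1 - q ^ (2 * n + 2)))"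
      unfolding T_def by (simp only: mult_ac)
    then have "d s = T s * (q ^ (2 * s) * (1 - q ^ (2 * n + 2)) - (1 - q ^ (2 * n + 1)))"
      unfolding d_def right_diff_distrib[of "T s"] by (simp only: mult.commute right_diff_distrib)
    moreover have "q ^ (2 * s) * (1 - q ^ (2 * n + 2)) - (1 - q ^ (2 * n + 1)) =
        q ^ (2 * n + 1) * (1 - q ^ (2 * s + 1)) - (1 - q ^ (2 * s))"
      by (simp add: algebra_simps power_add power2_eq_square)
    ultimately show ?thesis by (simp only: right_diff_distrib[symmetric] mult.assoc)
  qed
  \<comment> \<open>The positive part of \<open>d s\<close> in \<open>d_eq\<close> equals the
    subtracted part of \<open>d (Suc s)\<close>, which makes the sum of the \<open>d s\<close>
    telescope.\<close>
  have T_Suc: "T s * q ^ (2 * n + 1) * (1 - q ^ (2 * s + 1)) = T (Suc s) * (1 - q ^ (2 * Suc s))"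
    if "s < n" for s
  proof -
    have "A s n = (1 - q ^ (2 * Suc s)) * A (Suc s) n"
      unfolding A_def by (rule prod_greaterThanAtMost_Suc_left[OF that])
    moreover have "q ^ (Suc s * (2 * n + 1)) = q ^ (s * (2 * n + 1)) * q ^ (2 * n + 1)"
      by (simp add: power_add[symmetric] algebra_simps)
    ultimately show ?thesis unfolding T_def B_Suc by (simp only: mult_ac)
  qed
  \<comment> \<open>The lower end contributes nothing, because \<open>1 - q ^ (2 * s)\<close>
    vanishes at \<open>s = 0\<close>.\<close>
  have "(\<Sum>s<m. d s) = T m * (1 - q ^ (2 * m))" if "m \<le> n" for m
    using that
  proof (induction m)
    case (Suc m)
    then show ?case using d_eq[of m] T_Suc[of m] by simp
  qed simp
  then have sum_d: "(\<Sum>s\<le>n. d s) = T n * q ^ (2 * n + 1) * (1 - q ^ (2 * n + 1))"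
    using d_eq[of n] by (simp add: lessThan_Suc_atMost[symmetric])
  have T_n: "T n * q ^ (2 * n + 1) * (1 - q ^ (2 * n + 1)) = B (Suc n) * q ^ ((n + 1) * (2 * n + 1))"
  proof -
    have "q ^ ((n + 1) * (2 * n + 1)) = q ^ (n * (2 * n + 1)) * q ^ (2 * n + 1)"
      by (simp add: power_add[symmetric] algebra_simps)
    then show ?thesis unfolding T_def B_Suc A_self by (simp only: mult_ac mult_1_left)
  qed
  have IH: "B n * (\<Sum>j\<le>2 * n. q ^ (j * (j + 1) div 2)) = (\<Sum>s\<le>n. T s)"
    using Suc.IH by (simp add: A_def B_def T_def)
  have two_Suc: "2 * Suc n = Suc (Suc (2 * n))" by simp
  \<comment> \<open>These are the exponents of the two new terms of the triangular sum. The first is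
    matched by the telescoped sum of the \<open>d s\<close>, the second by the new summand
    \<open>s = Suc n\<close>.\<close>
  have "(2 * n + 1) * (2 * n + 1 + 1) div 2 = (n + 1) * (2 * n + 1)"
    "(2 * n + 2) * (2 * n + 2 + 1) div 2 = (n + 1) * (2 * n + 3)"
    by (rule div_nat_eqI; simp add: algebra_simps)+
  then have tri: "(\<Sum>j\<le>2 * Suc n. q ^ (j * (j + 1) div 2)) =
      (\<Sum>j\<le>2 * n. q ^ (j * (j + 1) div 2)) + q ^ ((n + 1) * (2 * n + 1)) + q ^ ((n + 1) * (2 * n + 3))"
    unfolding two_Suc sum.atMost_Suc by (simp add: add.assoc del: mult_Suc mult_Suc_right)
  have "(\<Sum>s\<le>Suc n. A s (Suc n) * B s * q ^ (s * (2 * n + 3))) =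
      (\<Sum>s\<le>n. d s) + (1 - q ^ (2 * n + 1)) * (\<Sum>s\<le>n. T s) + B (Suc n) * q ^ ((n + 1) * (2 * n + 3))"
    by (simp add: d_def sum_subtractf sum_distrib_left A_self)
  also have "\<dots> = B (Suc n) * (\<Sum>j\<le>2 * Suc n. q ^ (j * (j + 1) div 2))"
    unfolding sum_d T_n IH[symmetric] tri B_Suc by (simp add: algebra_simps)
  finally show ?case by (simp add: A_def B_def eval_nat_numeral)
qed

section \<open>The series \<open>psi(-q)\<close> and triangular numbers modulo 5\<close>

definition triangular_fps :: "int fps" where
  "triangular_fps = Abs_fps (\<lambda>n. \<Sum>j | j * (j + 1) div 2 = n. (-1) ^ n)"

lemma le_triangular: "j \<le> j * (j + 1) div (2::nat)"
  by (cases j) auto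

text \<open>Since \<open>j\<close> is at most the \<open>j\<close>-th triangular number, indices
  above \<open>N\<close> cannot affect coefficients up to \<open>N\<close>. This links the infinite
  series to the finite sum in \<open>shanks_identity\<close>.\<close>

lemma triangular_fps_nth:
  assumes "n \<le> N"
  shows "triangular_fps $ n = (\<Sum>j\<le>N. (- fps_X) ^ (j * (j + 1) div 2)) $ n"
proof -
  have "(\<Sum>j\<le>N. (- fps_X :: int fps) ^ (j * (j + 1) div 2)) $ n =
      (\<Sum>j\<le>N. if j * (j + 1) div 2 = n then (-1) ^ n else 0)"
    unfolding fps_sum_nth
  proof (rule sum.cong[OF refl])
    fix j
    show "((- fps_X :: int fps) ^ (j * (j + 1) div 2)) $ n = (if j * (j + 1) div 2 = n then (-1) ^ n else 0)"
      using power_minus[of "fps_X :: int fps" "j * (j + 1) div 2"]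
      by (cases "even (j * (j + 1) div 2)") (auto simp: fps_X_power_nth)
  qed
  also have "\<dots> = (\<Sum>j | j \<le> N \<and> j * (j + 1) div 2 = n. (-1) ^ n)"
    by (subst sum.inter_filter[symmetric]) auto
  also have "{j. j \<le> N \<and> j * (j + 1) div 2 = n} = {j. j * (j + 1) div 2 = n}"
    using le_triangular assms by (auto intro: order_trans)
  finally show ?thesis by (simp add: triangular_fps_def)
qed

text \<open>Because of the halving, the residue modulo 5 is determined by \<open>j\<close> modulo
  10, and ten cases remain.\<close>

lemma triangular_mod_5:
  fixes j :: nat
  shows "j * (j + 1) div 2 mod 5 \<in> {0, 1, 3}"
proof -
  have "j * (j + 1) div 2 mod 5 = j * (j + 1) mod 10 div 2"
    using mod_mult2_eq[of "j * (j + 1)" 2 5] by simp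
  also have "j * (j + 1) mod 10 = (j mod 10) * (j mod 10 + 1) mod 10"
    unfolding cong_def[symmetric] by (intro cong_mult cong_add cong_refl) (simp_all add: cong_def)
  also have "\<dots> div 2 \<in> {0, 1, 3}"
  proof -
    have "j mod 10 \<in> {0,1,2,3,4,5,6,7,8,9}"
      unfolding insert_iff empty_iff by presburger
    then show ?thesis by (elim insertE) auto
  qed
  finally show ?thesis .
qed

lemma triangular_fps_nth_eq_0:
  assumes "n mod 5 \<in> {2, 4}"
  shows "triangular_fps $ n = 0"
proof -
  have "j * (j + 1) div 2 \<noteq> n" for j
    using triangular_mod_5[of j] assms by (intro notI) auto
  then have "{j. j * (j + 1) div 2 = n} = {}" by simp
  then show ?thesis by (simp add: triangular_fps_def)
qed

section \<open>Partitions with bounded parts and their product formula\<close>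

definition pod_parts :: "nat \<Rightarrow> nat \<Rightarrow> nat multiset set" where
  "pod_parts m n = {p. is_partition p \<and> odd_parts_distinct p \<and> (\<forall>i\<in>#p. i \<le> m) \<and> sum_mset p = n}"

definition pod_parts_fps :: "nat \<Rightarrow> int fps" where
  "pod_parts_fps m = Abs_fps (\<lambda>n. int (card (pod_parts m n)))"

definition pod_fps :: "int fps" where
  "pod_fps = Abs_fps (\<lambda>n. int (pod_neg 1 n))"

lemma pod_tuples_1: "pod_tuples 1 n = (\<lambda>p. [p]) ` {p. is_partition p \<and> odd_parts_distinct p \<and> sum_mset p = n}"
  by (auto simp: pod_tuples_def length_Suc_conv)

lemma finite_pod_partitions: "finite {p. is_partition p \<and> odd_parts_distinct p \<and> sum_mset p = n}"
  using finite_pod_tuples[of 1 n] unfolding pod_tuples_1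
  by (rule finite_imageD) (auto simp: inj_on_def)

lemma pod_fps_nth: "pod_fps $ n = int (card {p. is_partition p \<and> odd_parts_distinct p \<and> sum_mset p = n})"
  unfolding pod_fps_def pod_neg_def pod_tuples_1
  by (simp add: card_image inj_on_def)

lemma finite_pod_parts: "finite (pod_parts m n)"
  by (rule finite_subset[OF _ finite_pod_partitions[of n]]) (auto simp: pod_parts_def)

lemma pod_parts_fps_nth:
  assumes "n \<le> m"
  shows "pod_parts_fps m $ n = pod_fps $ n"
proof -
  have "i \<le> sum_mset p" if "i \<in># p" for i and p :: "nat multiset"
    using that by (auto dest!: multi_member_split)
  then have "pod_parts m n = {p. is_partition p \<and> odd_parts_distinct p \<and> sum_mset p = n}"
    using assms by (fastforce simp: pod_parts_def intro: order_trans)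
  then show ?thesis by (simp add: pod_parts_fps_def pod_fps_nth)
qed

lemma pod_parts_fps_0: "pod_parts_fps 0 = 1"
proof -
  have "pod_parts 0 n = (if n = 0 then {{#}} else {})" for n
  proof -
    have "p \<in> pod_parts 0 n \<longleftrightarrow> p = {#} \<and> n = 0" for p
      by (cases p) (auto simp: pod_parts_def is_partition_def odd_parts_distinct_def)
    then show ?thesis by auto
  qed
  then show ?thesis by (intro fps_ext) (simp add: pod_parts_fps_def)
qed

text \<open>Partitions are split by whether \<open>Suc m\<close> occurs, and one copy is removed if
  it does. The set \<open>S\<close> of remainders is left abstract because it depends on parity: an
  odd \<open>Suc m\<close> cannot occur again, an even one can.\<close>

lemma card_pod_parts_Suc:
  assumes "\<And>p. p \<in> S \<longleftrightarrow> add_mset (Suc m) p \<in> pod_parts (Suc m) n"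
  shows "card (pod_parts (Suc m) n) = card (pod_parts m n) + card S"
proof -
  have "pod_parts (Suc m) n = pod_parts m n \<union> add_mset (Suc m) ` S"
  proof (intro equalityI subsetI)
    fix p assume p: "p \<in> pod_parts (Suc m) n"
    show "p \<in> pod_parts m n \<union> add_mset (Suc m) ` S"
    proof (cases "Suc m \<in># p")
      case True
      then obtain r where "p = add_mset (Suc m) r" by (auto dest: multi_member_split)
      then show ?thesis using p assms by auto
    next
      case False
      then have "i \<le> m" if "i \<in># p" for i
        using p that by (force simp: pod_parts_def le_Suc_eq)
      then show ?thesis using p by (auto simp: pod_parts_def)
    qed
  next
    fix p assume "p \<in> pod_parts m n \<union> add_mset (Suc m) ` S"
    then show "p \<in> pod_parts (Suc m) n"
      using assms by (auto simp: pod_parts_def intro: le_SucI)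
  qed
  moreover have "pod_parts m n \<inter> add_mset (Suc m) ` S = {}"
    by (auto simp: pod_parts_def)
  moreover have "finite (add_mset (Suc m) ` S)"
    using assms by (intro finite_subset[OF _ finite_pod_parts[of "Suc m" n]]) auto
  ultimately show ?thesis
    by (simp add: card_Un_disjoint finite_pod_parts card_image inj_on_def)
qed

lemma pod_parts_fps_Suc_odd:
  assumes "odd (Suc m)"
  shows "pod_parts_fps (Suc m) = (1 + fps_X ^ Suc m) * pod_parts_fps m"
proof (rule fps_ext)
  fix n
  \<comment> \<open>The case split is essential: for \<open>n < Suc m\<close> truncated subtraction
    would give 0, and the empty partition would be counted.\<close>
  define S where "S = (if n < Suc m then {} else pod_parts m (n - Suc m))"
  have "p \<in> S \<longleftrightarrow> add_mset (Suc m) p \<in> pod_parts (Suc m) n" for p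
  proof
    assume "p \<in> S"
    then have n: "\<not> n < Suc m" and p: "p \<in> pod_parts m (n - Suc m)"
      by (auto simp: S_def split: if_splits)
    from p have "count p (Suc m) = 0"
      by (auto simp: pod_parts_def count_eq_zero_iff)
    with n p show "add_mset (Suc m) p \<in> pod_parts (Suc m) n"
      by (auto simp: pod_parts_def is_partition_def odd_parts_distinct_def intro: le_SucI)
  next
    assume *: "add_mset (Suc m) p \<in> pod_parts (Suc m) n"
    then have "count (add_mset (Suc m) p) (Suc m) \<le> 1"
      using assms unfolding pod_parts_def odd_parts_distinct_def by blast
    then have "Suc m \<notin># p" by (simp add: count_eq_zero_iff)
    then have "i \<le> m" if "i \<in># p" for i
      using * that by (force simp: pod_parts_def le_Suc_eq)
    moreover have "odd_parts_distinct p"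
      unfolding odd_parts_distinct_def
    proof (intro allI impI)
      fix i :: nat assume "odd i"
      then have "count (add_mset (Suc m) p) i \<le> 1"
        using * unfolding pod_parts_def odd_parts_distinct_def by blast
      then show "count p i \<le> 1" by (simp split: if_splits)
    qed
    ultimately show "p \<in> S"
      using * by (auto simp: S_def pod_parts_def is_partition_def)
  qed
  then have "card (pod_parts (Suc m) n) = card (pod_parts m n) + card S"
    by (rule card_pod_parts_Suc)
  then show "pod_parts_fps (Suc m) $ n = ((1 + fps_X ^ Suc m) * pod_parts_fps m) $ n"
    by (simp add: pod_parts_fps_def S_def distrib_right fps_X_power_mult_nth del: power_Suc)
qed

lemma pod_parts_fps_Suc_even:
  assumes "even (Suc m)"
  shows "(1 - fps_X ^ Suc m) * pod_parts_fps (Suc m) = pod_parts_fps m"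
proof (rule fps_ext)
  fix n
  define S where "S = (if n < Suc m then {} else pod_parts (Suc m) (n - Suc m))"
  have opd: "odd_parts_distinct (add_mset (Suc m) p) \<longleftrightarrow> odd_parts_distinct p" for p
  proof -
    have "count (add_mset (Suc m) p) i = count p i" if "odd i" for i
      using that assms by auto
    then show ?thesis by (simp add: odd_parts_distinct_def)
  qed
  have "p \<in> S \<longleftrightarrow> add_mset (Suc m) p \<in> pod_parts (Suc m) n" for p
    by (auto simp: S_def pod_parts_def is_partition_def opd)
  then have "card (pod_parts (Suc m) n) = card (pod_parts m n) + card S"
    by (rule card_pod_parts_Suc)
  then show "((1 - fps_X ^ Suc m) * pod_parts_fps (Suc m)) $ n = pod_parts_fps m $ n"
    by (simp add: pod_parts_fps_def S_def left_diff_distrib fps_X_power_mult_nth del: power_Suc)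
qed

text \<open>The truncated Euler product, with the even factors kept on the left so that no inverse
  series is needed. The two products are those of \<open>shanks_identity\<close> at
  \<open>q = - fps_X\<close>.\<close>

lemma pod_parts_fps_product:
  "(\<Prod>k\<in>{0<..N}. 1 - fps_X ^ (2 * k)) * pod_parts_fps (2 * N) = (\<Prod>k<N. 1 + fps_X ^ (2 * k + 1))"
proof (induction N)
  case 0
  show ?case by (simp add: pod_parts_fps_0)
next
  case (Suc N)
  have "(\<Prod>k\<in>{0<..Suc N}. 1 - fps_X ^ (2 * k)) * pod_parts_fps (2 * Suc N) =
      (\<Prod>k\<in>{0<..N}. 1 - fps_X ^ (2 * k)) *
      ((1 - fps_X ^ Suc (2 * N + 1)) * pod_parts_fps (Suc (2 * N + 1)))"
    by (subst prod_greaterThanAtMost_Suc_right) (simp_all add: mult.assoc)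
  also have "\<dots> = (\<Prod>k\<in>{0<..N}. 1 - fps_X ^ (2 * k)) * pod_parts_fps (Suc (2 * N))"
    by (subst pod_parts_fps_Suc_even) simp_all
  also have "\<dots> = (1 + fps_X ^ Suc (2 * N)) *
      ((\<Prod>k\<in>{0<..N}. 1 - fps_X ^ (2 * k)) * pod_parts_fps (2 * N))"
    by (subst pod_parts_fps_Suc_odd) (simp_all only: mult_ac, simp)
  also have "\<dots> = (\<Prod>k<Suc N. 1 + fps_X ^ (2 * k + 1))"
    unfolding Suc.IH by (simp add: mult.commute)
  finally show ?case .
qed

section \<open>Comparing initial coefficients, and Gauss's identity\<close>

lemma fps_mult_nth_cong:
  fixes f g h :: "'a::semiring_0 fps"
  assumes "\<And>i. i \<le> n \<Longrightarrow> g $ i = h $ i"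
  shows "(f * g) $ n = (f * h) $ n"
  using assms by (simp add: fps_mult_nth)

text \<open>Multiplying by a series with nonzero constant term keeps the order of
  \<open>g - h\<close>. If that order were at most \<open>N\<close>, the two products would already
  differ there.\<close>

lemma fps_mult_nth_cancel:
  fixes f g h :: "'a::idom fps"
  assumes f0: "f $ 0 \<noteq> 0" and eq: "\<And>i. i \<le> N \<Longrightarrow> (f * g) $ i = (f * h) $ i" and "n \<le> N"
  shows "g $ n = h $ n"
proof (rule ccontr)
  assume "g $ n \<noteq> h $ n"
  then have nz: "g - h \<noteq> 0" and "subdegree (g - h) \<le> n"
    by (auto intro: subdegree_leI)
  moreover have "subdegree (f * (g - h)) = subdegree (g - h)"
    using f0 nz by (subst subdegree_mult) auto
  moreover have "f * (g - h) \<noteq> 0" using f0 nz by auto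
  ultimately have "(f * (g - h)) $ subdegree (g - h) \<noteq> 0"
    by (metis nth_subdegree_nonzero)
  with eq[of "subdegree (g - h)"] \<open>subdegree (g - h) \<le> n\<close> \<open>n \<le> N\<close>
  show False by (simp add: right_diff_distrib)
qed

theorem gauss_identity: "pod_fps * triangular_fps = 1"
proof (rule fps_ext)
  fix n
  define A where "A s = (\<Prod>k\<in>{s<..n}. 1 - fps_X ^ (2 * k) :: int fps)" for s
  define B where "B s = (\<Prod>k<s. 1 + fps_X ^ (2 * k + 1) :: int fps)" for s
  define P where "P = (\<Sum>j\<le>2 * n. (- fps_X :: int fps) ^ (j * (j + 1) div 2))"
  have "B n * P = (\<Sum>s\<le>n. A s * B s * (- fps_X) ^ (s * (2 * n + 1)))"
    using shanks_identity[of "- fps_X :: int fps" n]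
    by (simp add: A_def B_def P_def)
  also have "\<dots> = A 0 + (\<Sum>s\<in>{0<..n}. A s * B s * (- fps_X) ^ (s * (2 * n + 1)))"
  proof -
    have "{..n} = insert 0 {0<..n}" by auto
    then show ?thesis by (simp add: B_def)
  qed
  finally have shanks: "B n * P = A 0 + (\<Sum>s\<in>{0<..n}. A s * B s * (- fps_X) ^ (s * (2 * n + 1)))" .
  \<comment> \<open>Each summand with \<open>s > 0\<close> is divisible by a power of
    \<open>fps_X\<close> with exponent at least \<open>2 * n + 1\<close>, so only
    \<open>s = 0\<close> is visible up to degree \<open>n\<close>.\<close>
  have BP: "(B n * P) $ i = A 0 $ i" if "i \<le> n" for i
  proof -
    have "(A s * B s * (- fps_X) ^ (s * (2 * n + 1))) $ i = 0" if "s \<in> {0<..n}" for s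
    proof -
      have "i < 1 * (2 * n + 1)" using \<open>i \<le> n\<close> by simp
      also have "\<dots> \<le> s * (2 * n + 1)"
        using that by (intro mult_right_mono) auto
      finally have "i < s * (2 * n + 1)" .
      moreover have "A s * B s * (- fps_X) ^ (s * (2 * n + 1)) =
          fps_X ^ (s * (2 * n + 1)) * ((-1) ^ (s * (2 * n + 1)) * (A s * B s))"
        by (subst power_minus) (simp only: mult_ac)
      ultimately show ?thesis by (simp only: fps_X_power_mult_nth if_True)
    qed
    then show ?thesis unfolding shanks by (simp add: fps_sum_nth)
  qed
  have AF: "A 0 * pod_parts_fps (2 * n) = B n"
    unfolding A_def B_def by (rule pod_parts_fps_product)
  have B0: "B m $ 0 = 1" for m by (induction m) (simp_all add: B_def)
  \<comment> \<open>Up to degree \<open>n\<close>, \<open>B n * P\<close> may be replaced by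
    \<open>A 0\<close>, and \<open>AF\<close> turns the product back into \<open>B n\<close>, which
    can then be cancelled.\<close>
  have "(B n * (pod_parts_fps (2 * n) * P)) $ i = (B n * 1) $ i" if "i \<le> n" for i
  proof -
    have "(pod_parts_fps (2 * n) * (B n * P)) $ i = (pod_parts_fps (2 * n) * A 0) $ i"
      using BP that by (intro fps_mult_nth_cong) auto
    then show ?thesis using AF by (simp add: mult_ac)
  qed
  then have "(pod_parts_fps (2 * n) * P) $ n = 1 $ n"
    by (rule fps_mult_nth_cancel[of "B n" n, rotated]) (simp_all add: B0)
  moreover have "(pod_fps * triangular_fps) $ n = (pod_parts_fps (2 * n) * P) $ n"
    unfolding fps_mult_nth P_def
    by (intro sum.cong refl) (simp add: pod_parts_fps_nth triangular_fps_nth[of _ "2 * n"])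
  ultimately show "(pod_fps * triangular_fps) $ n = 1 $ n" by simp
qed

section \<open>Powers of the generating function and divisibility by 5\<close>

theorem pod_fps_power_nth: "(pod_fps ^ k) $ n = int (pod_neg k n)"
proof (induction k arbitrary: n)
  case 0
  have "pod_tuples 0 n = (if n = 0 then {[]} else {})"
    by (auto simp: pod_tuples_def)
  then show ?case by (simp add: pod_neg_def)
next
  case (Suc k)
  define Q where "Q i = {p. is_partition p \<and> odd_parts_distinct p \<and> sum_mset p = i}" for i
  \<comment> \<open>Grouping by the size \<open>i\<close> of the first partition gives exactly the
    convolution that defines the product of \<open>pod_fps\<close> and
    \<open>pod_fps ^ k\<close>.\<close>
  have "pod_tuples (Suc k) n = (\<lambda>(p, ps). p # ps) ` (\<Union>i\<le>n. Q i \<times> pod_tuples k (n - i))"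
  proof (intro equalityI subsetI)
    fix x assume "x \<in> pod_tuples (Suc k) n"
    moreover from this obtain p ps where x: "x = p # ps"
      by (auto simp: pod_tuples_def length_Suc_conv)
    ultimately have "p \<in> Q (sum_mset p)" "sum_mset p \<le> n" "ps \<in> pod_tuples k (n - sum_mset p)"
      by (auto simp: pod_tuples_def Q_def)
    then have "(p, ps) \<in> (\<Union>i\<le>n. Q i \<times> pod_tuples k (n - i))" by blast
    then show "x \<in> (\<lambda>(p, ps). p # ps) ` (\<Union>i\<le>n. Q i \<times> pod_tuples k (n - i))"
      unfolding x by (rule rev_image_eqI) simp
  qed (auto simp: pod_tuples_def Q_def)
  then have "pod_neg (Suc k) n = card (\<Union>i\<le>n. Q i \<times> pod_tuples k (n - i))"
    unfolding pod_neg_def by (simp add: card_image inj_on_def)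
  also have "\<dots> = (\<Sum>i\<le>n. card (Q i \<times> pod_tuples k (n - i)))"
    by (intro card_UN_disjoint)
      (auto simp: finite_pod_tuples finite_pod_partitions Q_def)
  also have "\<dots> = (\<Sum>i\<le>n. card (Q i) * pod_neg k (n - i))"
    by (simp add: card_cartesian_product pod_neg_def)
  finally show ?case
    by (simp add: fps_mult_nth Suc.IH pod_fps_nth Q_def atLeast0AtMost)
qed

text \<open>Differentiating \<open>f ^ p\<close> produces a factor \<open>p\<close> and multiplies
  the coefficient at \<open>n\<close> by \<open>n\<close>, which is prime to
  \<open>p\<close>.\<close>

lemma prime_dvd_fps_power_nth:
  fixes f :: "int fps"
  assumes "prime p" and "\<not> p dvd n"
  shows "int p dvd (f ^ p) $ n"
proof -
  obtain m where n: "n = Suc m" using assms(2) by (cases n) auto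
  have "int n * (f ^ p) $ n = fps_deriv (f ^ p) $ m"
    by (simp add: n)
  also have "\<dots> = int p * (fps_deriv f * f ^ (p - 1)) $ m"
    by (simp add: fps_deriv_power' mult.assoc fps_of_nat[symmetric])
  finally have "int p dvd int n * (f ^ p) $ n" by simp
  moreover have "\<not> int p dvd int n" using assms(2) by simp
  ultimately show ?thesis
    using assms(1) by (simp add: prime_dvd_mult_iff)
qed

text \<open>Every term of the convolution of \<open>pod_fps ^ 5\<close> with
  \<open>triangular_fps\<close> is divisible by 5: if 5 does not divide \<open>i\<close>, by the
  first factor; otherwise \<open>n - i\<close> has the residue of \<open>n\<close>, and the second
  factor is 0.\<close>

theorem five_dvd_pod_neg_4:
  assumes "n mod 5 \<in> {2, 4}"
  shows "5 dvd pod_neg 4 n"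
proof -
  have "pod_fps ^ 4 = pod_fps ^ 5 * triangular_fps"
    using gauss_identity by (simp add: eval_nat_numeral mult_ac)
  then have "int (pod_neg 4 n) = (\<Sum>i=0..n. (pod_fps ^ 5) $ i * triangular_fps $ (n - i))"
    by (simp add: pod_fps_power_nth[symmetric] fps_mult_nth)
  moreover have "5 dvd (pod_fps ^ 5) $ i * triangular_fps $ (n - i)" if "i \<in> {0..n}" for i
  proof (cases "5 dvd i")
    case True
    then have "(n - i) mod 5 = n mod 5"
      using that by (metis atLeastAtMost_iff le_add_diff_inverse dvd_def
          mod_mult_self4)
    then show ?thesis using assms triangular_fps_nth_eq_0 by simp
  next
    case False
    then show ?thesis using prime_dvd_fps_power_nth[of 5 i pod_fps] by simp
  qed
  ultimately have "int 5 dvd int (pod_neg 4 n)" by (simp only: dvd_sum of_nat_numeral)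
  then show ?thesis by (simp only: of_nat_dvd_iff)
qed

theorem corollary4p1:
  fixes n :: nat
  shows "[pod_neg 4 (5 * n + 2) = pod_neg 4 (5 * n + 4)] (mod 5) \<and>
         [pod_neg 4 (5 * n + 4) = 0] (mod 5)"
proof -
  have "5 dvd pod_neg 4 (5 * n + 2)" "5 dvd pod_neg 4 (5 * n + 4)"
    by (rule five_dvd_pod_neg_4, simp only: mod_mult_self4, simp)+
  then show ?thesis by (auto simp: cong_def)
qed

end
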